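(* Let $\Omega\subset\mathbb{R}^d$ be a domain, let $h>0$, let $n,\ell,r\ge 0$ be integers, and set $m=\min\{n,\ell\}$. Let $\{I,W,P\}$ be an approximation scheme on $\Omega$. Suppose that: (i) the scheme is $n$-consistent; (ii) there exists $\tau>0$ such that $P$ has $h$-density bounded by $\tau$; (iii) the scheme has polynomial decay of order $(r,s)$ for some constant $c>0$ and for this $h$, with $2s>d+m+1$. Let $u\in C^{\ell+1}(\overline{\operatorname{conv}}(\Omega))$. Then there exists a constant $C<\infty$ such that $$\left|D^{\alpha}u_I(x)-D^{\alpha}u(x)\right|\le C\,\|D^{m+1}u\|_{\infty}\,h^{m+1-|\alpha|}$$ for every multiindex $\alpha$ with $|\alpha|\le\min\{m,r\}$ and every $x\in\Omega$.
   Context: A domain is an open and bounded subset of $\mathbb{R}^d$; $\overline{\operatorname{conv}}$ denotes the closed convex hull. An approximation scheme $\{I,W,P\}$ on $\Omega$ consists of a finite index set $I$, a collection $W=\{w_a: a\in I\}$ of functions $w_a:\Omega\to\mathbb{R}$ (shape functions) and a finite point set $P=\{x_a: a\in I\}\subset\mathbb{R}^d$ indexed one-to-one by $I$. For a function $u$, $u_I(x)=\sum_{a\in I}u(x_a)w_a(x)$; it is understood that this is well defined, i.e. that every node $x_a$ lies in the set where $u$ is defined (here $\overline{\operatorname{conv}}(\Omega)$). $n$-consistency: $x^\alpha=\sum_{a\in I}x_a^\alpha w_a(x)$ for all $x\in\Omega$ and all multiindices $\alpha$ with $|\alpha|\le n$. $P$ has $h$-density bounded by $\tau$ if $\#(P\cap\bar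 B(x,h))\le\tau$ for every $x\in\mathbb{R}^d$, where $\bar B(x,h)$ is the closed ball. The scheme has polynomial decay of order $(r,s)$ for constants $c>0$ and $h>0$ if every $w_a\in C^r(\Omega)$ and $$\sup_{|\alpha|\le r}\ \sup_{x\in\Omega}\ \sup_{a\in I}\Big(1+\Big|\frac{x-x_a}{h}\Big|^2\Big)^s h^{|\alpha|}|D^\alpha w_a(x)|<c.$$ $\|D^{m+1}u\|_\infty=\max_{|\alpha|=m+1}\sup_{\overline{\operatorname{conv}}(\Omega)}|D^\alpha u|$. *)

theory Defs
  imports "HOL-Analysis.Analysis"
begin

text \<open>A multiindex on $\mathbb{R}^d$ is a function \<open>\<alpha> :: 'd \<Rightarrow> nat\<close>, where the finite
  type \<open>'d\<close> indexes the coordinates.\<close>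

definition mi_size :: "('d::finite \<Rightarrow> nat) \<Rightarrow> nat" where
  "mi_size \<alpha> = (\<Sum>i\<in>UNIV. \<alpha> i)"

definition mi_power :: "real ^ 'd \<Rightarrow> ('d::finite \<Rightarrow> nat) \<Rightarrow> real" where
  "mi_power x \<alpha> = (\<Prod>i\<in>UNIV. (x $ i) ^ \<alpha> i)"

definition partial_deriv :: "'d::finite \<Rightarrow> (real ^ 'd \<Rightarrow> real) \<Rightarrow> real ^ 'd \<Rightarrow> real" where
  "partial_deriv i f x = deriv (\<lambda>t. f (x + t *\<^sub>R axis i 1)) 0"

definition has_partial_deriv_at :: "'d::finite \<Rightarrow> (real ^ 'd \<Rightarrow> real) \<Rightarrow> real ^ 'd \<Rightarrow> bool" where
  "has_partial_deriv_at i f x \<longleftrightarrow> (\<lambda>t. f (x + t *\<^sub>R axis i 1)) differentiable (at 0)"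

text \<open>The mixed derivative \<open>D\<^sup>\<alpha>\<close> differentiates \<open>\<alpha> i\<close> times in each coordinate \<open>i\<close>. The index
  type carries no order, so the order of differentiation is fixed by a choice; for \<open>C\<^sup>k\<close>
  functions and \<open>\<bar>\<alpha>\<bar> \<le> k\<close> it is immaterial by Schwarz's theorem.\<close>

definition mi_list :: "('d::finite \<Rightarrow> nat) \<Rightarrow> 'd list" where
  "mi_list \<alpha> = (SOME is. \<forall>i. count_list is i = \<alpha> i)"

lemma count_list_mi_list: "count_list (mi_list \<alpha>) i = \<alpha> i"
proof -
  obtain M where M: "\<And>i. count M i = \<alpha> i"
    by (rule that[of "Abs_multiset \<alpha>"]) (simp add: count_Abs_multiset)
  obtain js where "mset js = M"
    using ex_mset by blast
  then have "\<forall>i. count_list js i = \<alpha> i"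
    using M by (metis count_mset)
  then have "\<forall>i. count_list (mi_list \<alpha>) i = \<alpha> i"
    unfolding mi_list_def by (rule someI)
  then show ?thesis by blast
qed

definition mi_deriv :: "('d::finite \<Rightarrow> nat) \<Rightarrow> (real ^ 'd \<Rightarrow> real) \<Rightarrow> real ^ 'd \<Rightarrow> real" where
  "mi_deriv \<alpha> f = foldr partial_deriv (mi_list \<alpha>) f"

text \<open>\<open>C\<^sup>k(S)\<close>, meant for open \<open>S\<close>; the values of \<open>f\<close> outside \<open>S\<close> play no role.\<close>

primrec Ck_on :: "nat \<Rightarrow> (real ^ 'd::finite) set \<Rightarrow> (real ^ 'd \<Rightarrow> real) \<Rightarrow> bool" where
  "Ck_on 0 S f \<longleftrightarrow> continuous_on S f"
| "Ck_on (Suc k) S f \<longleftrightarrow> continuous_on S f \<and>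
     (\<forall>i. (\<forall>x\<in>S. has_partial_deriv_at i f x) \<and> Ck_on k S (partial_deriv i f))"

text \<open>\<open>C\<^sup>k(K)\<close> for \<open>K\<close> the closure of an open convex set: the function is continuous on \<open>K\<close>,
  it is \<open>C\<^sup>k\<close> in the interior of \<open>K\<close>, and all its derivatives up to order \<open>k\<close> extend
  continuously to \<open>K\<close>. On the boundary of \<open>K\<close>, the derivatives are the values of these extensions.\<close>

definition Ck_closed :: "nat \<Rightarrow> (real ^ 'd::finite) set \<Rightarrow> (real ^ 'd \<Rightarrow> real) \<Rightarrow> bool" where
  "Ck_closed k K u \<longleftrightarrow> continuous_on K u \<and> Ck_on k (interior K) u \<and>
     (\<forall>\<alpha>. mi_size \<alpha> \<le> k \<longrightarrow>
        (\<exists>g. continuous_on K g \<and> (\<forall>x\<in>interior K. g x = mi_deriv \<alpha> u x)))"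

definition mi_deriv_closed ::
    "(real ^ 'd) set \<Rightarrow> ('d::finite \<Rightarrow> nat) \<Rightarrow> (real ^ 'd \<Rightarrow> real) \<Rightarrow> real ^ 'd \<Rightarrow> real" where
  "mi_deriv_closed K \<alpha> u x =
     (if x \<in> interior K then mi_deriv \<alpha> u x else Lim (at x within interior K) (mi_deriv \<alpha> u))"

definition deriv_sup_norm :: "nat \<Rightarrow> (real ^ 'd::finite) set \<Rightarrow> (real ^ 'd \<Rightarrow> real) \<Rightarrow> real" where
  "deriv_sup_norm k K u =
     Max ((\<lambda>\<alpha>. SUP x\<in>K. \<bar>mi_deriv_closed K \<alpha> u x\<bar>) ` {\<alpha>. mi_size \<alpha> = k})"

definition is_domain :: "(real ^ 'd::finite) set \<Rightarrow> bool" where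
  "is_domain \<Omega> \<longleftrightarrow> open \<Omega> \<and> bounded \<Omega>"

definition closed_conv :: "(real ^ 'd::finite) set \<Rightarrow> (real ^ 'd) set" where
  "closed_conv \<Omega> = closure (convex hull \<Omega>)"

text \<open>An approximation scheme consists of the index set \<open>I\<close>, the shape functions \<open>w a\<close> and
  the nodes \<open>X a\<close>; the point set is \<open>P = X ` I\<close>. The shape functions are only
  relevant on the domain \<open>\<Omega>\<close>.\<close>

definition approx_scheme :: "'i set \<Rightarrow> ('i \<Rightarrow> real ^ 'd::finite) \<Rightarrow> bool" where
  "approx_scheme I X \<longleftrightarrow> finite I \<and> inj_on X I"

definition approximant ::
    "'i set \<Rightarrow> ('i \<Rightarrow> real ^ 'd \<Rightarrow> real) \<Rightarrow> ('i \<Rightarrow> real ^ 'd::finite)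
      \<Rightarrow> (real ^ 'd \<Rightarrow> real) \<Rightarrow> real ^ 'd \<Rightarrow> real" where
  "approximant I w X u x = (\<Sum>a\<in>I. u (X a) * w a x)"

definition consistent ::
    "nat \<Rightarrow> (real ^ 'd) set \<Rightarrow> 'i set \<Rightarrow> ('i \<Rightarrow> real ^ 'd \<Rightarrow> real) \<Rightarrow> ('i \<Rightarrow> real ^ 'd::finite)
      \<Rightarrow> bool" where
  "consistent n \<Omega> I w X \<longleftrightarrow>
     (\<forall>x\<in>\<Omega>. \<forall>\<alpha>. mi_size \<alpha> \<le> n \<longrightarrow> mi_power x \<alpha> = (\<Sum>a\<in>I. mi_power (X a) \<alpha> * w a x))"

definition density_bounded :: "real \<Rightarrow> real \<Rightarrow> (real ^ 'd::finite) set \<Rightarrow> bool" where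
  "density_bounded h \<tau> P \<longleftrightarrow> (\<forall>x. real (card (P \<inter> cball x h)) \<le> \<tau>)"

text \<open>The supremum is taken in the extended reals, so that \<open>< c\<close> entails its finiteness.\<close>

definition poly_decay ::
    "nat \<Rightarrow> real \<Rightarrow> real \<Rightarrow> real \<Rightarrow> (real ^ 'd) set \<Rightarrow> 'i set \<Rightarrow> ('i \<Rightarrow> real ^ 'd \<Rightarrow> real)
      \<Rightarrow> ('i \<Rightarrow> real ^ 'd::finite) \<Rightarrow> bool" where
  "poly_decay r s c h \<Omega> I w X \<longleftrightarrow>
     (\<forall>a\<in>I. Ck_on r \<Omega> (w a)) \<and>
     (SUP \<alpha>\<in>{\<alpha>. mi_size \<alpha> \<le> r}. SUP x\<in>\<Omega>. SUP a\<in>I.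
        ereal ((1 + (norm ((x - X a) /\<^sub>R h))\<^sup>2) powr s * h ^ mi_size \<alpha> * \<bar>mi_deriv \<alpha> (w a) x\<bar>))
      < ereal c"

end

theory Submission
  imports Defs
begin

text \<open>Let \<open>T\<close> be the Taylor polynomial of degree \<open>m\<close> of \<open>u\<close> at the fixed point \<open>x \<in> \<Omega>\<close>. By consistency
  \<open>T\<^sub>I = T\<close> on \<open>\<Omega>\<close>, and \<open>D\<^sup>\<alpha> T x = D\<^sup>\<alpha> u x\<close>; so the error at \<open>x\<close> is
  \<open>\<Sum>a\<in>I. (u - T)(x\<^sub>a) D\<^sup>\<alpha> w\<^sub>a(x)\<close>. Taylor's theorem and the decay bound each term by a multiple of
  \<open>\<parallel>D\<^bsup>m+1\<^esup> u\<parallel> h\<^bsup>m+1-|\<alpha>|\<^esup> (1 + |(x - x\<^sub>a)/h|\<^sup>2)\<^bsup>(m+1)/2-s\<^esup>\<close>. The density bound allows \<open>O(2\<^bsup>kd\<^esup>)\<close>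
  nodes within distance \<open>2\<^sup>k h\<close> of \<open>x\<close>, so the sum over the dyadic shells is dominated by a geometric
  series that converges as \<open>2 s > d + m + 1\<close>.

  Taylor polynomials are built from the iterated directional derivatives \<open>(\<Sum>\<^sub>i v\<^sub>i \<partial>\<^sub>i)\<^sup>k u\<close>
  instead of multiindex coefficients. By Schwarz's theorem \<open>\<partial>\<^sub>j\<close> maps the Taylor polynomial
  of \<open>u\<close> of degree \<open>m+1\<close> to that of \<open>\<partial>\<^sub>j u\<close> of degree \<open>m\<close>, and no factorials of multiindices
  are needed.\<close>

section \<open>Symmetry of mixed partial derivatives\<close>

lemma partial_deriv_line:
  fixes x :: "real ^ 'd::finite"
  assumes "has_partial_deriv_at i f (x + t *\<^sub>R axis i 1)"
  shows "((\<lambda>r. f (x + r *\<^sub>R axis i 1)) has_real_derivative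
    partial_deriv i f (x + t *\<^sub>R axis i 1)) (at t)"
proof -
  have "((\<lambda>r. f (x + t *\<^sub>R axis i 1 + r *\<^sub>R axis i 1)) has_real_derivative
    partial_deriv i f (x + t *\<^sub>R axis i 1)) (at 0)"
    using assms unfolding has_partial_deriv_at_def partial_deriv_def
    by (simp add: DERIV_deriv_iff_real_differentiable)
  then have "((\<lambda>r. f (x + (r + t) *\<^sub>R axis i 1)) has_real_derivative
    partial_deriv i f (x + t *\<^sub>R axis i 1)) (at 0)"
    by (simp add: algebra_simps)
  then show ?thesis
    using DERIV_shift[of "\<lambda>r. f (x + r *\<^sub>R axis i 1)" _ 0 t] by simp
qed

lemma partial_deriv_at:
  assumes "has_partial_deriv_at i f x"
  shows "((\<lambda>t. f (x + t *\<^sub>R axis i 1)) has_real_derivative partial_deriv i f x) (at 0)"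
  using partial_deriv_line[of i f x 0] assms by simp

lemma partial_deriv_cong:
  assumes "open S" "x \<in> S" "\<And>y. y \<in> S \<Longrightarrow> f y = g y"
  shows "partial_deriv i f x = partial_deriv i g x"
proof -
  have "((\<lambda>t::real. x + t *\<^sub>R axis i 1) \<longlongrightarrow> x + 0 *\<^sub>R axis i 1) (nhds 0)"
    by (intro tendsto_intros filterlim_ident)
  then have "\<forall>\<^sub>F t in nhds 0. x + t *\<^sub>R axis i (1::real) \<in> S"
    using assms topological_tendstoD by fastforce
  then have "\<forall>\<^sub>F t in nhds 0. f (x + t *\<^sub>R axis i 1) = g (x + t *\<^sub>R axis i 1)"
    using assms(3) by (auto elim: eventually_mono)
  then show ?thesis
    unfolding partial_deriv_def by (intro deriv_cong_ev) auto
qed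

lemma foldr_partial_deriv_cong:
  assumes "open S" "\<And>y. y \<in> S \<Longrightarrow> f y = g y" "x \<in> S"
  shows "foldr partial_deriv is f x = foldr partial_deriv is g x"
  using assms(3)
proof (induction "is" arbitrary: x)
  case (Cons i "is")
  show ?case
    unfolding foldr.simps o_apply
    by (rule partial_deriv_cong[OF assms(1) Cons.prems Cons.IH])
qed (simp add: assms)

lemma Ck_on_continuous: "Ck_on k S f \<Longrightarrow> continuous_on S f"
  by (cases k) auto

lemma Ck_on_Suc_imp: "Ck_on (Suc k) S f \<Longrightarrow> Ck_on k S f"
  by (induction k arbitrary: f) (auto intro: Ck_on_continuous)

lemma Ck_on_mono: "Ck_on k S f \<Longrightarrow> j \<le> k \<Longrightarrow> Ck_on j S f"
  by (induction k) (auto simp: le_Suc_eq dest: Ck_on_Suc_imp simp del: Ck_on.simps(2))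

lemma Ck_on_foldr_partial_deriv:
  "Ck_on (length is + k) S f \<Longrightarrow> Ck_on k S (foldr partial_deriv is f)"
proof (induction "is" arbitrary: k)
  case (Cons i "is")
  then have "Ck_on (Suc k) S (foldr partial_deriv is f)"
    by (metis add_Suc_shift length_Cons)
  then show ?case by simp
qed simp

text \<open>The mean value theorem is applied twice: to \<open>\<phi>\<close> along axis
  \<open>i\<close>, then to \<open>partial_deriv i f\<close> along axis \<open>j\<close>. The second
  difference is symmetric in \<open>i\<close> and \<open>j\<close>, so exchanging the axes leads to
  Schwarz's theorem.\<close>

lemma second_difference:
  fixes x :: "real ^ 'd::finite"
  assumes f: "Ck_on 2 S f" and s: "0 < s" and ball: "ball x e \<subseteq> S" "2 * s < e"
  shows "\<exists>y. dist x y \<le> 2 * s \<and>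
    f (x + s *\<^sub>R axis i 1 + s *\<^sub>R axis j 1) - f (x + s *\<^sub>R axis i 1) -
    f (x + s *\<^sub>R axis j 1) + f x = s\<^sup>2 * partial_deriv j (partial_deriv i f) y"
proof -
  \<comment> \<open>The triangle inequality gives a radius that also covers the case
    \<open>i = j\<close>.\<close>
  have near: "dist x (x + a *\<^sub>R axis i 1 + b *\<^sub>R axis j 1) \<le> 2 * s"
    if "0 \<le> a" "a \<le> s" "0 \<le> b" "b \<le> s" for a b :: real
  proof -
    have "norm (a *\<^sub>R axis i 1 + b *\<^sub>R axis j (1::real)) \<le> norm (a *\<^sub>R axis i (1::real)) + norm (b *\<^sub>R axis j (1::real))"
      by (rule norm_triangle_ineq)
    also have "\<dots> \<le> 2 * s" using that by simp
    finally show ?thesis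
      by (simp add: dist_norm algebra_simps norm_minus_commute)
  qed
  have S: "x + a *\<^sub>R axis i 1 + b *\<^sub>R axis j 1 \<in> S"
    if "0 \<le> a" "a \<le> s" "0 \<le> b" "b \<le> s" for a b :: real
    using near[OF that] ball by (auto simp: subset_iff)
  have f1: "has_partial_deriv_at i f y" and f2: "has_partial_deriv_at j (partial_deriv i f) y"
    if "y \<in> S" for y
    using f that by (auto simp: numeral_2_eq_2)
  define \<phi> where "\<phi> t = f (x + s *\<^sub>R axis j 1 + t *\<^sub>R axis i 1) - f (x + t *\<^sub>R axis i 1)" for t
  have "\<exists>z>0. z < s \<and> \<phi> s - \<phi> 0 = (s - 0) *
      (partial_deriv i f (x + s *\<^sub>R axis j 1 + z *\<^sub>R axis i 1) - partial_deriv i f (x + z *\<^sub>R axis i 1))"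
    unfolding \<phi>_def
  proof (rule MVT2)
    fix t assume t: "0 \<le> t" "t \<le> s"
    have "x + s *\<^sub>R axis j 1 + t *\<^sub>R axis i 1 \<in> S" "x + t *\<^sub>R axis i 1 \<in> S"
      using S[of t s] S[of t 0] t s by (auto simp: ac_simps)
    then show "((\<lambda>t. f (x + s *\<^sub>R axis j 1 + t *\<^sub>R axis i 1) - f (x + t *\<^sub>R axis i 1)) has_real_derivative
       partial_deriv i f (x + s *\<^sub>R axis j 1 + t *\<^sub>R axis i 1) - partial_deriv i f (x + t *\<^sub>R axis i 1)) (at t)"
      by (intro derivative_intros partial_deriv_line f1)
  qed (use s in auto)
  then obtain p where p: "0 < p" "p < s" and \<phi>: "\<phi> s - \<phi> 0 = s *
      (partial_deriv i f (x + s *\<^sub>R axis j 1 + p *\<^sub>R axis i 1) - partial_deriv i f (x + p *\<^sub>R axis i 1))"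
    by auto
  have "\<exists>z>0. z < s \<and> partial_deriv i f (x + p *\<^sub>R axis i 1 + s *\<^sub>R axis j 1) -
      partial_deriv i f (x + p *\<^sub>R axis i 1 + 0 *\<^sub>R axis j 1) = (s - 0) *
      partial_deriv j (partial_deriv i f) (x + p *\<^sub>R axis i 1 + z *\<^sub>R axis j 1)"
    by (rule MVT2) (use s p S in \<open>auto intro!: partial_deriv_line f2\<close>)
  then obtain q where q: "0 < q" "q < s" and
    "partial_deriv i f (x + p *\<^sub>R axis i 1 + s *\<^sub>R axis j 1) -
      partial_deriv i f (x + p *\<^sub>R axis i 1) = s *
      partial_deriv j (partial_deriv i f) (x + p *\<^sub>R axis i 1 + q *\<^sub>R axis j 1)"
    by auto
  with \<phi> have "\<phi> s - \<phi> 0 = s\<^sup>2 * partial_deriv j (partial_deriv i f) (x + p *\<^sub>R axis i 1 + q *\<^sub>R axis j 1)"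
    by (simp add: power2_eq_square ac_simps)
  with near[of p q] p q show ?thesis
    by (intro exI[of _ "x + p *\<^sub>R axis i 1 + q *\<^sub>R axis j 1"]) (simp add: \<phi>_def ac_simps)
qed

text \<open>The same second difference is \<open>s\<^sup>2\<close> times either mixed derivative,
  each evaluated at some point within \<open>2 * s\<close> of \<open>x\<close>. Continuity of both
  at \<open>x\<close> then forces equality.\<close>

lemma partial_deriv_commute:
  fixes x :: "real ^ 'd::finite"
  assumes f: "Ck_on 2 S f" and S: "open S" "x \<in> S"
  shows "partial_deriv i (partial_deriv j f) x = partial_deriv j (partial_deriv i f) x"
proof -
  let ?F = "partial_deriv i (partial_deriv j f)" and ?G = "partial_deriv j (partial_deriv i f)"
  have "continuous_on S ?F" "continuous_on S ?G"
    using f by (auto simp: numeral_2_eq_2)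
  then have cont: "isCont ?F x" "isCont ?G x"
    using S by (auto simp: continuous_on_eq_continuous_at)
  have "\<bar>?F x - ?G x\<bar> \<le> \<epsilon>" if "\<epsilon> > 0" for \<epsilon> :: real
  proof -
    have half: "\<epsilon> / 2 > 0" using that by simp
    obtain d1 where d1: "d1 > 0" "\<And>y. dist y x < d1 \<Longrightarrow> dist (?F y) (?F x) < \<epsilon> / 2"
      using cont(1)[unfolded continuous_at_eps_delta, rule_format, OF half] by blast
    obtain d2 where d2: "d2 > 0" "\<And>y. dist y x < d2 \<Longrightarrow> dist (?G y) (?G x) < \<epsilon> / 2"
      using cont(2)[unfolded continuous_at_eps_delta, rule_format, OF half] by blast
    obtain d3 where d3: "d3 > 0" "ball x d3 \<subseteq> S"
      using S open_contains_ball by blast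
    \<comment> \<open>Dividing by 3 makes \<open>2 * s\<close> strictly smaller than all three
      radii.\<close>
    define s where "s = min d1 (min d2 d3) / 3"
    have s: "s > 0" "2 * s < d1" "2 * s < d2" "2 * s < d3"
      using d1 d2 d3 by (auto simp: s_def)
    obtain y where y: "dist x y \<le> 2 * s" and y': "f (x + s *\<^sub>R axis j 1 + s *\<^sub>R axis i 1) -
        f (x + s *\<^sub>R axis j 1) - f (x + s *\<^sub>R axis i 1) + f x = s\<^sup>2 * ?F y"
      using second_difference[OF f s(1) d3(2) s(4), of j i] by blast
    obtain z where z: "dist x z \<le> 2 * s" and z': "f (x + s *\<^sub>R axis i 1 + s *\<^sub>R axis j 1) -
        f (x + s *\<^sub>R axis i 1) - f (x + s *\<^sub>R axis j 1) + f x = s\<^sup>2 * ?G z"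
      using second_difference[OF f s(1) d3(2) s(4), of i j] by blast
    have "s\<^sup>2 * ?F y = s\<^sup>2 * ?G z"
      unfolding y'[symmetric] z'[symmetric] by (simp add: ac_simps)
    then have "?F y = ?G z" using s by simp
    moreover have "\<bar>?F y - ?F x\<bar> < \<epsilon> / 2"
      using d1(2)[of y] y s by (auto simp: dist_real_def dist_commute)
    moreover have "\<bar>?G z - ?G x\<bar> < \<epsilon> / 2"
      using d2(2)[of z] z s by (auto simp: dist_real_def dist_commute)
    ultimately show ?thesis by linarith
  qed
  then have "\<bar>?F x - ?G x\<bar> \<le> 0" by (rule field_le_epsilon) auto
  then show ?thesis by simp
qed

text \<open>The induction hypothesis is an equality on all of the open set \<open>S\<close>, so it
  may be differentiated once more; a single swap of two derivatives then finishes the step.\<close>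

lemma foldr_partial_deriv_commute:
  fixes x :: "real ^ 'd::finite"
  assumes f: "Ck_on (Suc (length is)) S f" and S: "open S" "x \<in> S"
  shows "foldr partial_deriv is (partial_deriv j f) x = partial_deriv j (foldr partial_deriv is f) x"
  using assms
proof (induction "is" arbitrary: x)
  case (Cons i "is")
  have "Ck_on (Suc (length is)) S f"
    using Cons.prems(1) Ck_on_Suc_imp by (simp del: Ck_on.simps(2))
  then have "foldr partial_deriv (i # is) (partial_deriv j f) x
      = partial_deriv i (partial_deriv j (foldr partial_deriv is f)) x"
    using Cons.IH Cons.prems(2,3) by (simp, intro partial_deriv_cong[OF S(1)]) auto
  also have "\<dots> = partial_deriv j (partial_deriv i (foldr partial_deriv is f)) x"
    using Cons.prems by (intro partial_deriv_commute[of S] Ck_on_foldr_partial_deriv)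
      (auto simp: numeral_2_eq_2)
  finally show ?case by simp
qed simp

text \<open>Makes the arbitrary enumeration behind \<open>mi_list\<close> immaterial. The head
  \<open>i\<close> occurs somewhere in \<open>js = ps @ i # qs\<close>; the induction hypothesis
  rearranges the tail into \<open>ps @ qs\<close>, and the previous lemma moves \<open>i\<close>
  inwards past \<open>ps\<close>.\<close>

lemma foldr_partial_deriv_perm:
  fixes x :: "real ^ 'd::finite"
  assumes "mset is = mset js" "Ck_on (length is) S f" and S: "open S" "x \<in> S"
  shows "foldr partial_deriv is f x = foldr partial_deriv js f x"
  using assms
proof (induction "is" arbitrary: js x)
  case (Cons i "is")
  obtain ps qs where js: "js = ps @ i # qs"
    using Cons.prems(1) by (metis list.set_intros(1) mset_eq_setD split_list)
  then have perm: "mset is = mset (ps @ qs)" using Cons.prems(1) by simp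
  then have len: "length is = length ps + length qs"
    by (metis length_append mset_eq_length)
  have "Ck_on (length is) S f"
    using Cons.prems(2) Ck_on_Suc_imp by (simp del: Ck_on.simps(2))
  then have "foldr partial_deriv (i # is) f x = partial_deriv i (foldr partial_deriv (ps @ qs) f) x"
    using Cons.IH[OF perm] Cons.prems(3,4) by (simp, intro partial_deriv_cong[OF S(1)]) auto
  also have "\<dots> = foldr partial_deriv ps (partial_deriv i (foldr partial_deriv qs f)) x"
    using Cons.prems len
    by (simp del: Ck_on.simps(2), intro foldr_partial_deriv_commute[symmetric, of _ S] Ck_on_foldr_partial_deriv)
       (auto simp: ac_simps simp del: Ck_on.simps(2))
  finally show ?case by (simp add: js)
qed simp

lemma length_mi_list: "length (mi_list \<alpha>) = mi_size \<alpha>"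
proof -
  have "length (mi_list \<alpha>) = (\<Sum>i\<in>set (mi_list \<alpha>). count_list (mi_list \<alpha>) i)"
    by (rule sum_count_set[symmetric]) auto
  also have "\<dots> = (\<Sum>i\<in>UNIV. count_list (mi_list \<alpha>) i)"
    by (rule sum.mono_neutral_left) (auto simp: count_list_0_iff)
  finally show ?thesis by (simp add: count_list_mi_list mi_size_def)
qed

text \<open>Transfers bounds on \<open>mi_deriv\<close> to arbitrary sequences of partial
  derivatives, the form in which Taylor's theorem uses them.\<close>

lemma foldr_partial_deriv_eq_mi_deriv:
  fixes x :: "real ^ 'd::finite"
  assumes "Ck_on (length is) S f" "open S" "x \<in> S"
  shows "foldr partial_deriv is f x = mi_deriv (count_list is) f x"
    and "mi_size (count_list is) = length is"
proof -
  have "mset is = mset (mi_list (count_list is))"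
    by (intro multiset_eqI) (metis count_list_mi_list count_mset)
  then show "foldr partial_deriv is f x = mi_deriv (count_list is) f x"
    and "mi_size (count_list is) = length is"
    unfolding mi_deriv_def using foldr_partial_deriv_perm assms
    by (blast, metis length_mi_list mset_eq_length)
qed

lemma foldr_partial_deriv_sum:
  fixes x :: "real ^ 'd::finite"
  assumes "\<And>a. a \<in> I \<Longrightarrow> Ck_on (length is) S (w a)" and S: "open S" "x \<in> S"
  shows "foldr partial_deriv is (\<lambda>z. \<Sum>a\<in>I. b a * w a z) x
    = (\<Sum>a\<in>I. b a * foldr partial_deriv is (w a) x)"
  using assms
proof (induction "is" arbitrary: x)
  case (Cons i "is")
  have w: "Ck_on (Suc 0) S (foldr partial_deriv is (w a))" if "a \<in> I" for a
    using Cons.prems(1)[OF that] by (intro Ck_on_foldr_partial_deriv) simp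
  have "Ck_on (length is) S (w a)" if "a \<in> I" for a
    by (rule Ck_on_Suc_imp) (use Cons.prems(1)[OF that] in \<open>simp del: Ck_on.simps(2)\<close>)
  then have "foldr partial_deriv (i # is) (\<lambda>z. \<Sum>a\<in>I. b a * w a z) x
      = partial_deriv i (\<lambda>z. \<Sum>a\<in>I. b a * foldr partial_deriv is (w a) z) x"
    using Cons.IH Cons.prems(2,3) by (simp, intro partial_deriv_cong[OF S(1)]) auto
  also have "\<dots> = (\<Sum>a\<in>I. b a * partial_deriv i (foldr partial_deriv is (w a)) x)"
    unfolding partial_deriv_def[of i "\<lambda>z. \<Sum>a\<in>I. _ a z"]
    by (intro DERIV_imp_deriv DERIV_sum DERIV_cmult partial_deriv_at) (use w Cons.prems in auto)
  finally show ?case by simp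
qed simp

section \<open>Taylor polynomials\<close>

text \<open>The way from \<open>x\<close> to \<open>x + v\<close> is travelled one coordinate at a
  time, with the mean value theorem on each axis-parallel segment; \<open>A\<close> is the set of
  coordinates already moved. The bound on the 1-norm of \<open>v\<close> keeps the whole path in the
  ball.\<close>

lemma Ck_on_1_increment:
  fixes x v :: "real ^ 'd::finite"
  assumes f: "Ck_on 1 S f" and ball: "ball x \<delta> \<subseteq> S"
    and \<epsilon>: "\<And>i y. y \<in> ball x \<delta> \<Longrightarrow> \<bar>partial_deriv i f y - partial_deriv i f x\<bar> \<le> \<epsilon>"
    and v: "(\<Sum>i\<in>UNIV. \<bar>v $ i\<bar>) < \<delta>"
  shows "\<bar>f (x + (\<Sum>i\<in>A. v $ i *\<^sub>R axis i 1)) - f x - (\<Sum>i\<in>A. v $ i * partial_deriv i f x)\<bar>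
    \<le> \<epsilon> * (\<Sum>i\<in>A. \<bar>v $ i\<bar>)"
  using finite[of A]
proof (induction A rule: finite_induct)
  case (insert i A)
  define b where "b = x + (\<Sum>i\<in>A. v $ i *\<^sub>R axis i 1)"
  have near: "b + (t * v $ i) *\<^sub>R axis i 1 \<in> ball x \<delta>" if "0 \<le> t" "t \<le> 1" for t :: real
  proof -
    have "norm ((\<Sum>i\<in>A. v $ i *\<^sub>R axis i (1::real)) + (t * v $ i) *\<^sub>R axis i 1)
        \<le> (\<Sum>i\<in>A. \<bar>v $ i\<bar>) + \<bar>t * v $ i\<bar>"
      by (intro norm_triangle_mono sum_norm_le) auto
    also have "\<dots> \<le> (\<Sum>i\<in>A. \<bar>v $ i\<bar>) + \<bar>v $ i\<bar>"
      using that by (auto simp: abs_mult intro: mult_left_le_one_le)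
    also have "\<dots> = (\<Sum>i\<in>insert i A. \<bar>v $ i\<bar>)" using insert by simp
    also have "\<dots> \<le> (\<Sum>i\<in>UNIV. \<bar>v $ i\<bar>)" by (rule sum_mono2) auto
    also have "\<dots> < \<delta>" by (rule v)
    finally have "dist x (x + ((\<Sum>i\<in>A. v $ i *\<^sub>R axis i (1::real)) + (t * v $ i) *\<^sub>R axis i 1)) < \<delta>"
      unfolding dist_norm by (subst norm_minus_commute) simp
    then show ?thesis by (simp only: b_def mem_ball add.assoc)
  qed
  \<comment> \<open>Parametrising the segment by \<open>t\<close> in the unit interval avoids a case
    distinction on the sign or vanishing of \<open>v $ i\<close>.\<close>
  have "((\<lambda>t. f (b + (t * v $ i) *\<^sub>R axis i 1)) has_real_derivative
      partial_deriv i f (b + (t * v $ i) *\<^sub>R axis i 1) * v $ i) (at t)" if "0 \<le> t" "t \<le> 1" for t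
  proof (rule DERIV_chain2[where f = "\<lambda>r. f (b + r *\<^sub>R axis i 1)"])
    show "((\<lambda>r. f (b + r *\<^sub>R axis i 1)) has_real_derivative
      partial_deriv i f (b + (t * v $ i) *\<^sub>R axis i 1)) (at (t * v $ i))"
      using f ball near[OF that] by (intro partial_deriv_line) auto
  qed (auto intro!: derivative_eq_intros)
  then have "\<exists>z>0. z < 1 \<and> f (b + (1 * v $ i) *\<^sub>R axis i 1) - f (b + (0 * v $ i) *\<^sub>R axis i 1)
      = (1 - 0) * (partial_deriv i f (b + (z * v $ i) *\<^sub>R axis i 1) * v $ i)"
    by (intro MVT2) auto
  then obtain t where t: "0 < t" "t < 1" and
    mvt: "f (b + v $ i *\<^sub>R axis i 1) - f b = partial_deriv i f (b + (t * v $ i) *\<^sub>R axis i 1) * v $ i"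
    by auto
  define D where "D = partial_deriv i f (b + (t * v $ i) *\<^sub>R axis i 1) - partial_deriv i f x"
  have "\<bar>D * v $ i\<bar> \<le> \<epsilon> * \<bar>v $ i\<bar>"
    unfolding abs_mult D_def by (intro mult_right_mono \<epsilon> near) (use t in auto)
  moreover have "f (x + (\<Sum>i\<in>insert i A. v $ i *\<^sub>R axis i 1)) = f b + v $ i * partial_deriv i f x + D * v $ i"
    using mvt insert.hyps by (simp add: D_def b_def algebra_simps)
  moreover have "\<bar>f b - f x - (\<Sum>i\<in>A. v $ i * partial_deriv i f x)\<bar> \<le> \<epsilon> * (\<Sum>i\<in>A. \<bar>v $ i\<bar>)"
    using insert.IH by (simp add: b_def)
  moreover have "\<epsilon> * (\<Sum>i\<in>insert i A. \<bar>v $ i\<bar>) = \<epsilon> * \<bar>v $ i\<bar> + \<epsilon> * (\<Sum>i\<in>A. \<bar>v $ i\<bar>)"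
    "(\<Sum>i\<in>insert i A. v $ i * partial_deriv i f x)
      = v $ i * partial_deriv i f x + (\<Sum>i\<in>A. v $ i * partial_deriv i f x)"
    using insert.hyps by (simp_all add: distrib_left)
  ultimately show ?case by linarith
qed simp

lemma sum_abs_le_card_mult_norm: "(\<Sum>i\<in>UNIV. \<bar>v $ i\<bar>) \<le> CARD('d) * norm (v :: real ^ 'd::finite)"
  using sum_bounded_above[of UNIV "\<lambda>i. \<bar>v $ i\<bar>" "norm v"] component_le_norm_cart[of v] by simp

text \<open>\<open>Ck_on\<close> only speaks of derivatives along the axes. Total differentiability
  is what gives the chain rule along lines in arbitrary directions.\<close>

lemma Ck_on_1_has_derivative:
  fixes x :: "real ^ 'd::finite"
  assumes f: "Ck_on 1 S f" and S: "open S" "x \<in> S"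
  shows "(f has_derivative (\<lambda>v. \<Sum>i\<in>UNIV. v $ i * partial_deriv i f x)) (at x)"
  unfolding has_derivative_at_alt
proof (intro conjI allI impI)
  show "bounded_linear (\<lambda>v. \<Sum>i\<in>UNIV. v $ i * partial_deriv i f x)"
    by (intro bounded_linear_sum bounded_linear_mult_const bounded_linear_vec_nth)
  fix e :: real assume e: "e > 0"
  \<comment> \<open>The divisor pays for passing from the 1-norm to the Euclidean norm.\<close>
  let ?\<epsilon> = "e / CARD('d)"
  have "\<forall>\<^sub>F y in nhds x. y \<in> S \<and> (\<forall>i\<in>UNIV. \<bar>partial_deriv i f y - partial_deriv i f x\<bar> \<le> ?\<epsilon>)"
  proof (intro eventually_conj eventually_ball_finite ballI)
    show "\<forall>\<^sub>F y in nhds x. y \<in> S" using S by (simp add: eventually_nhds_in_open)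
    fix i
    have "continuous_on S (partial_deriv i f)" using f by simp
    then have "isCont (partial_deriv i f) x"
      using S by (auto simp: continuous_on_eq_continuous_at)
    then have "\<forall>\<^sub>F y in nhds x. dist (partial_deriv i f y) (partial_deriv i f x) < ?\<epsilon>"
      using e by (intro tendstoD) (auto simp: isCont_def tendsto_at_iff_tendsto_nhds)
    then show "\<forall>\<^sub>F y in nhds x. \<bar>partial_deriv i f y - partial_deriv i f x\<bar> \<le> ?\<epsilon>"
      by (rule eventually_mono) (simp add: dist_real_def)
  qed auto
  then obtain \<delta> where \<delta>: "\<delta> > 0" "\<And>y. dist y x < \<delta> \<Longrightarrow> y \<in> S \<and> (\<forall>i. \<bar>partial_deriv i f y - partial_deriv i f x\<bar> \<le> ?\<epsilon>)"
    unfolding eventually_nhds_metric by auto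
  show "\<exists>d>0. \<forall>y. norm (y - x) < d \<longrightarrow>
      norm (f y - f x - (\<Sum>i\<in>UNIV. (y - x) $ i * partial_deriv i f x)) \<le> e * norm (y - x)"
  proof (intro exI[of _ "\<delta> / CARD('d)"] conjI allI impI)
    show "0 < \<delta> / CARD('d)" using \<delta> by simp
    fix y assume y: "norm (y - x) < \<delta> / CARD('d)"
    define v where "v = y - x"
    have "(\<Sum>i\<in>UNIV. \<bar>v $ i\<bar>) < \<delta>"
      using sum_abs_le_card_mult_norm[of v] y by (simp add: v_def field_simps)
    then have "\<bar>f (x + (\<Sum>i\<in>UNIV. v $ i *\<^sub>R axis i 1)) - f x - (\<Sum>i\<in>UNIV. v $ i * partial_deriv i f x)\<bar>
        \<le> ?\<epsilon> * (\<Sum>i\<in>UNIV. \<bar>v $ i\<bar>)"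
      using \<delta>(2) by (intro Ck_on_1_increment[OF f, of x \<delta>]) (auto simp: dist_commute)
    also have "(\<Sum>i\<in>UNIV. v $ i *\<^sub>R axis i 1) = v"
      using basis_expansion[of v] by (simp add: scalar_mult_eq_scaleR)
    also have "?\<epsilon> * (\<Sum>i\<in>UNIV. \<bar>v $ i\<bar>) \<le> ?\<epsilon> * (CARD('d) * norm v)"
      using e by (intro mult_left_mono sum_abs_le_card_mult_norm) auto
    finally show "norm (f y - f x - (\<Sum>i\<in>UNIV. (y - x) $ i * partial_deriv i f x)) \<le> e * norm (y - x)"
      by (simp add: v_def)
  qed
qed

text \<open>Each new partial derivative acts innermost, directly on \<open>u\<close>, so inductions
  on \<open>k\<close> generalise \<open>u\<close>. The direction \<open>v\<close> and the point
  \<open>z\<close> are separate arguments: the Taylor polynomial fixes \<open>z\<close> and varies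
  \<open>v\<close>, its remainder fixes \<open>v\<close> and moves \<open>z\<close> along a
  line.\<close>

primrec iter_dir_deriv ::
    "nat \<Rightarrow> (real ^ 'd::finite \<Rightarrow> real) \<Rightarrow> real ^ 'd \<Rightarrow> real ^ 'd \<Rightarrow> real" where
  "iter_dir_deriv 0 u v z = u z"
| "iter_dir_deriv (Suc k) u v z = (\<Sum>i\<in>UNIV. v $ i * iter_dir_deriv k (partial_deriv i u) v z)"

lemma iter_dir_deriv_cong:
  assumes "open S" "x \<in> S" "\<And>y. y \<in> S \<Longrightarrow> f y = g y"
  shows "iter_dir_deriv k f v x = iter_dir_deriv k g v x"
  using assms(3)
proof (induction k arbitrary: f g)
  case (Suc k)
  have "iter_dir_deriv k (partial_deriv i f) v x = iter_dir_deriv k (partial_deriv i g) v x" for i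
  proof (rule Suc.IH)
    fix y assume "y \<in> S"
    then show "partial_deriv i f y = partial_deriv i g y"
      by (rule partial_deriv_cong[OF assms(1) _ Suc.prems])
  qed
  then show ?case by simp
qed (simp add: assms)

text \<open>Identifies the successive derivatives of \<open>u\<close> along a line. The base case is
  the chain rule; the step differentiates the defining sum termwise.\<close>

lemma iter_dir_deriv_line:
  assumes "Ck_on (Suc k) S u" and S: "open S" "z + t *\<^sub>R v \<in> S"
  shows "((\<lambda>r. iter_dir_deriv k u v (z + r *\<^sub>R v)) has_real_derivative
    iter_dir_deriv (Suc k) u v (z + t *\<^sub>R v)) (at t)"
  using assms(1)
proof (induction k arbitrary: u)
  case 0
  have "((\<lambda>r. z + r *\<^sub>R v) has_derivative (\<lambda>r. r *\<^sub>R v)) (at t)"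
    by (auto intro!: derivative_eq_intros)
  from diff_chain_at[OF this Ck_on_1_has_derivative[OF _ S]] 0
  have "((\<lambda>r. u (z + r *\<^sub>R v)) has_derivative
      (\<lambda>r. \<Sum>i\<in>UNIV. (r *\<^sub>R v) $ i * partial_deriv i u (z + t *\<^sub>R v))) (at t)"
    by (simp add: o_def)
  then show ?case
    unfolding has_field_derivative_def iter_dir_deriv.simps
    by (rule has_derivative_eq_rhs) (auto simp: fun_eq_iff sum_distrib_left sum_distrib_right ac_simps)
next
  case (Suc k)
  have "((\<lambda>r. iter_dir_deriv k (partial_deriv i u) v (z + r *\<^sub>R v)) has_real_derivative
      iter_dir_deriv (Suc k) (partial_deriv i u) v (z + t *\<^sub>R v)) (at t)" for i
    by (rule Suc.IH) (use Suc.prems in simp)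
  then show ?case
    unfolding iter_dir_deriv.simps(2)[of k u] iter_dir_deriv.simps(2)[of "Suc k" u]
    by (intro DERIV_sum DERIV_cmult)
qed

text \<open>Expanding gives one term per index sequence of length \<open>k\<close>; the absolute
  values of the corresponding products of components of \<open>v\<close> add up to the
  \<open>k\<close>-th power of the 1-norm.\<close>

lemma abs_iter_dir_deriv_le:
  assumes "\<And>is. length is = k \<Longrightarrow> \<bar>foldr partial_deriv is u z\<bar> \<le> N"
  shows "\<bar>iter_dir_deriv k u v z\<bar> \<le> (\<Sum>i\<in>UNIV. \<bar>v $ i\<bar>) ^ k * N"
  using assms
proof (induction k arbitrary: u)
  case 0
  from 0[of "[]"] show ?case by simp
next
  case (Suc k)
  have "\<bar>iter_dir_deriv (Suc k) u v z\<bar> \<le> (\<Sum>i\<in>UNIV. \<bar>v $ i * iter_dir_deriv k (partial_deriv i u) v z\<bar>)"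
    by (simp add: sum_abs)
  also have "\<dots> \<le> (\<Sum>i\<in>UNIV. \<bar>v $ i\<bar> * ((\<Sum>i\<in>UNIV. \<bar>v $ i\<bar>) ^ k * N))"
  proof (rule sum_mono, unfold abs_mult, rule mult_left_mono)
    fix i
    show "\<bar>iter_dir_deriv k (partial_deriv i u) v z\<bar> \<le> (\<Sum>i\<in>UNIV. \<bar>v $ i\<bar>) ^ k * N"
      \<comment> \<open>The derivative along \<open>i\<close> is innermost, hence the last entry of
        the list.\<close>
      by (rule Suc.IH) (use Suc.prems[of "_ @ [i]"] in simp)
  qed auto
  also have "\<dots> = (\<Sum>i\<in>UNIV. \<bar>v $ i\<bar>) ^ Suc k * N"
    by (simp add: sum_distrib_right[symmetric] mult.assoc)
  finally show ?case .
qed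

text \<open>This differentiates in the direction \<open>v\<close>, in which the expression is
  homogeneous of degree \<open>k\<close>. The product rule yields one term from the outer factor
  and, by induction, \<open>k\<close> more. For \<open>k = 0\<close> the truncated
  \<open>k - 1\<close> is harmless, as the factor \<open>real k\<close> vanishes.\<close>

lemma iter_dir_deriv_axis:
  fixes x :: "real ^ 'd::finite"
  assumes "Ck_on k S u" and S: "open S" "x \<in> S"
  shows "((\<lambda>t. iter_dir_deriv k u (v + t *\<^sub>R axis j 1) x) has_real_derivative
    real k * iter_dir_deriv (k - 1) (partial_deriv j u) v x) (at 0)"
  using assms(1)
proof (induction k arbitrary: u)
  case (Suc k)
  let ?\<delta> = "\<lambda>i. axis j 1 $ i :: real"
  \<comment> \<open>Schwarz's theorem needs two orders of regularity, which are available for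
    \<open>k > 0\<close>; for \<open>k = 0\<close> both sides are zero.\<close>
  have swap: "real k * iter_dir_deriv (k - 1) (partial_deriv j (partial_deriv i u)) v x
      = real k * iter_dir_deriv (k - 1) (partial_deriv i (partial_deriv j u)) v x" for i
  proof (cases k)
    case (Suc k')
    have "Ck_on 2 S u"
      by (rule Ck_on_mono[OF Suc.prems(1)]) (simp add: \<open>k = Suc k'\<close>)
    then show ?thesis
      using iter_dir_deriv_cong[OF S, of "partial_deriv j (partial_deriv i u)" "partial_deriv i (partial_deriv j u)"]
        partial_deriv_commute[OF _ S(1)] by metis
  qed simp
  have "((\<lambda>t. (v $ i + t * ?\<delta> i) * iter_dir_deriv k (partial_deriv i u) (v + t *\<^sub>R axis j 1) x)
      has_real_derivative ?\<delta> i * iter_dir_deriv k (partial_deriv i u) v x +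
        v $ i * (real k * iter_dir_deriv (k - 1) (partial_deriv i (partial_deriv j u)) v x)) (at 0)" for i
    using Suc.prems unfolding swap[symmetric]
    by (auto intro!: derivative_eq_intros Suc.IH)
  then have "((\<lambda>t. \<Sum>i\<in>UNIV. (v $ i + t * ?\<delta> i) * iter_dir_deriv k (partial_deriv i u) (v + t *\<^sub>R axis j 1) x)
      has_real_derivative (\<Sum>i\<in>UNIV. ?\<delta> i * iter_dir_deriv k (partial_deriv i u) v x +
        v $ i * (real k * iter_dir_deriv (k - 1) (partial_deriv i (partial_deriv j u)) v x))) (at 0)"
    by (intro DERIV_sum)
  also have "(\<Sum>i\<in>UNIV. ?\<delta> i * iter_dir_deriv k (partial_deriv i u) v x +
        v $ i * (real k * iter_dir_deriv (k - 1) (partial_deriv i (partial_deriv j u)) v x))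
      = iter_dir_deriv k (partial_deriv j u) v x +
        real k * (\<Sum>i\<in>UNIV. v $ i * iter_dir_deriv (k - 1) (partial_deriv i (partial_deriv j u)) v x)"
  proof -
    have "(\<Sum>i\<in>UNIV. ?\<delta> i * iter_dir_deriv k (partial_deriv i u) v x)
        = (\<Sum>i\<in>UNIV. if i = j then iter_dir_deriv k (partial_deriv j u) v x else 0)"
      by (rule sum.cong) (auto simp: axis_def)
    then show ?thesis by (simp add: sum.distrib sum_distrib_left ac_simps)
  qed
  also have "\<dots> = real (Suc k) * iter_dir_deriv k (partial_deriv j u) v x"
    by (cases k) (auto simp: algebra_simps)
  finally show ?case by simp
qed simp

definition taylor_poly ::
    "nat \<Rightarrow> (real ^ 'd::finite \<Rightarrow> real) \<Rightarrow> real ^ 'd \<Rightarrow> real ^ 'd \<Rightarrow> real" where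
  "taylor_poly m u x y = (\<Sum>k\<le>m. iter_dir_deriv k u (y - x) x / fact k)"

lemma taylor_poly_center [simp]: "taylor_poly m u x x = u x"
proof -
  have "iter_dir_deriv k u 0 x = (if k = 0 then u x else 0)" for k
    by (cases k) auto
  then have "taylor_poly m u x x = (\<Sum>k\<le>m. if k = 0 then u x else 0)"
    unfolding taylor_poly_def by (intro sum.cong) (simp_all only: diff_self split: if_splits, auto)
  then show ?thesis by simp
qed

text \<open>The factor \<open>k\<close> produced by differentiation cancels against the factorial,
  and the term for \<open>k = 0\<close> drops out. The identity holds for all arguments, since only
  the center has to lie in \<open>S\<close>.\<close>

lemma partial_deriv_taylor_poly:
  fixes x :: "real ^ 'd::finite"
  assumes "Ck_on (Suc m) S u" and S: "open S" "x \<in> S"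
  shows "partial_deriv j (taylor_poly (Suc m) u x) = taylor_poly m (partial_deriv j u) x"
proof
  fix y
  have "Ck_on k S u" if "k \<le> Suc m" for k using Ck_on_mono[OF assms(1) that] .
  then have "((\<lambda>t. \<Sum>k\<le>Suc m. iter_dir_deriv k u (y - x + t *\<^sub>R axis j 1) x / fact k) has_real_derivative
     (\<Sum>k\<le>Suc m. real k * iter_dir_deriv (k - 1) (partial_deriv j u) (y - x) x / fact k)) (at 0)"
    by (intro DERIV_sum DERIV_cdivide iter_dir_deriv_axis[OF _ S]) auto
  then have "partial_deriv j (taylor_poly (Suc m) u x) y
      = (\<Sum>k\<le>Suc m. real k * iter_dir_deriv (k - 1) (partial_deriv j u) (y - x) x / fact k)"
    unfolding partial_deriv_def[of j "taylor_poly _ _ _"] taylor_poly_def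
    by (intro DERIV_imp_deriv) (simp only: algebra_simps)
  also have "\<dots> = taylor_poly m (partial_deriv j u) x y"
    unfolding taylor_poly_def sum.atMost_Suc_shift by (simp add: fact_Suc del: of_nat_Suc)
  finally show "partial_deriv j (taylor_poly (Suc m) u x) y = taylor_poly m (partial_deriv j u) x y" .
qed

lemma foldr_partial_deriv_taylor_poly:
  fixes x :: "real ^ 'd::finite"
  assumes "Ck_on (length js + m) S u" and S: "open S" "x \<in> S"
  shows "foldr partial_deriv js (taylor_poly (length js + m) u x) = taylor_poly m (foldr partial_deriv js u) x"
  using assms(1)
proof (induction js arbitrary: m)
  case (Cons j js)
  have *: "Ck_on (length js + Suc m) S u" using Cons.prems by simp
  from Cons.IH[OF *] partial_deriv_taylor_poly[OF Ck_on_foldr_partial_deriv[OF *] S, of j]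
  show ?case by simp
qed simp

text \<open>Differentiating leaves the Taylor polynomial of \<open>mi_deriv \<alpha> u\<close> of
  degree \<open>m - mi_size \<alpha>\<close>, whose value at the center is that derivative
  itself.\<close>

lemma mi_deriv_taylor_poly:
  fixes x :: "real ^ 'd::finite"
  assumes "Ck_on m S u" "mi_size \<alpha> \<le> m" "open S" "x \<in> S"
  shows "mi_deriv \<alpha> (taylor_poly m u x) x = mi_deriv \<alpha> u x"
  using foldr_partial_deriv_taylor_poly[of "mi_list \<alpha>" "m - mi_size \<alpha>" S u x] assms
  by (simp add: mi_deriv_def length_mi_list)

text \<open>One-dimensional Taylor expansion with Lagrange remainder along the segment from
  \<open>x\<close> to \<open>y\<close>. The factorial is then discarded and the 1-norm replaced by a
  multiple of the Euclidean norm.\<close>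

lemma taylor_remainder:
  fixes x y :: "real ^ 'd::finite"
  assumes u: "Ck_on (Suc m) S u" and S: "open S" "convex S" "x \<in> S" "y \<in> S"
    and N: "\<And>z is. z \<in> S \<Longrightarrow> length is = Suc m \<Longrightarrow> \<bar>foldr partial_deriv is u z\<bar> \<le> N"
  shows "\<bar>u y - taylor_poly m u x y\<bar> \<le> (CARD('d) * norm (y - x)) ^ Suc m * N"
proof -
  define v where "v = y - x"
  have seg: "x + t *\<^sub>R v \<in> S" if "0 \<le> t" "t \<le> 1" for t
    using convexD_alt[OF S(2,3,4) that] by (simp add: v_def algebra_simps)
  have "\<exists>t::real. 0 < t \<and> t < 1 \<and> u (x + 1 *\<^sub>R v)
      = (\<Sum>k<Suc m. iter_dir_deriv k u v (x + 0 *\<^sub>R v) / fact k * 1 ^ k)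
        + iter_dir_deriv (Suc m) u v (x + t *\<^sub>R v) / fact (Suc m) * 1 ^ Suc m"
  proof (rule Maclaurin[where diff = "\<lambda>k t. iter_dir_deriv k u v (x + t *\<^sub>R v)"], safe)
    fix k t assume "k < Suc m" "0 \<le> t" "t \<le> (1::real)"
    then show "((\<lambda>t. iter_dir_deriv k u v (x + t *\<^sub>R v)) has_real_derivative
        iter_dir_deriv (Suc k) u v (x + t *\<^sub>R v)) (at t)"
      by (intro iter_dir_deriv_line[OF Ck_on_mono[OF u] S(1)] seg) simp_all
  qed auto
  then obtain t where t: "0 < t" "t < 1" and
    "u y = taylor_poly m u x y + iter_dir_deriv (Suc m) u v (x + t *\<^sub>R v) / fact (Suc m)"
    by (auto simp: v_def taylor_poly_def lessThan_Suc_atMost simp del: iter_dir_deriv.simps fact_Suc)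
  then have "\<bar>u y - taylor_poly m u x y\<bar> = \<bar>iter_dir_deriv (Suc m) u v (x + t *\<^sub>R v)\<bar> / fact (Suc m)"
    by (simp del: iter_dir_deriv.simps fact_Suc)
  also have "\<dots> \<le> \<bar>iter_dir_deriv (Suc m) u v (x + t *\<^sub>R v)\<bar>"
    by (simp add: divide_le_eq mult_le_cancel_left1 fact_ge_1 del: iter_dir_deriv.simps fact_Suc)
  also have "\<dots> \<le> (\<Sum>i\<in>UNIV. \<bar>v $ i\<bar>) ^ Suc m * N"
    using t by (intro abs_iter_dir_deriv_le N seg) auto
  also have "\<dots> \<le> (CARD('d) * norm (y - x)) ^ Suc m * N"
  proof (intro mult_right_mono power_mono)
    \<comment> \<open>Any list of length \<open>Suc m\<close> at the point \<open>x\<close> shows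
      this; its entries do not matter.\<close>
    show "0 \<le> N" using N[OF S(3), of "replicate (Suc m) undefined"] by (metis abs_ge_zero length_replicate order_trans)
  qed (use sum_abs_le_card_mult_norm[of v] in \<open>auto simp: v_def intro: sum_nonneg\<close>)
  finally show ?thesis .
qed

section \<open>Polynomial reproduction\<close>

text \<open>Polynomials of degree at most \<open>n\<close>, generated by sums rather than
  coefficient families, so that consistency carries over by rule induction.\<close>

inductive poly_fun :: "nat \<Rightarrow> (real ^ 'd::finite \<Rightarrow> real) \<Rightarrow> bool" for n where
  monom: "mi_size \<alpha> \<le> n \<Longrightarrow> poly_fun n (\<lambda>y. c * mi_power y \<alpha>)"
| add: "poly_fun n p \<Longrightarrow> poly_fun n q \<Longrightarrow> poly_fun n (\<lambda>y. p y + q y)"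

lemma poly_fun_mono: "poly_fun n p \<Longrightarrow> n \<le> n' \<Longrightarrow> poly_fun n' p"
  by (induction rule: poly_fun.induct) (auto intro: poly_fun.intros)

lemma poly_fun_const: "poly_fun n (\<lambda>y. c)"
  using poly_fun.monom[of "\<lambda>_. 0" n c] by (simp add: mi_size_def mi_power_def)

lemma poly_fun_cmult: "poly_fun n p \<Longrightarrow> poly_fun n (\<lambda>y. c * p y)"
proof (induction rule: poly_fun.induct)
  case (monom \<alpha> b)
  then show ?case using poly_fun.monom[of \<alpha> n "c * b"] by (simp add: ac_simps)
next
  case (add p q)
  then show ?case using poly_fun.add by (simp add: distrib_left)
qed

lemma poly_fun_sum:
  "(\<And>a. a \<in> A \<Longrightarrow> poly_fun n (p a)) \<Longrightarrow> poly_fun n (\<lambda>y. \<Sum>a\<in>A. p a y)"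
  by (induction A rule: infinite_finite_induct) (auto intro: poly_fun_const poly_fun.add)

lemma poly_fun_coord_mult: "poly_fun n p \<Longrightarrow> poly_fun (Suc n) (\<lambda>y. y $ i * p y)"
proof (induction rule: poly_fun.induct)
  case (monom \<alpha> c)
  let ?\<beta> = "\<alpha>(i := Suc (\<alpha> i))"
  have "mi_size ?\<beta> = Suc (mi_size \<alpha>)"
    unfolding mi_size_def by (simp add: sum.remove[of UNIV i])
  moreover have "mi_power y ?\<beta> = y $ i * mi_power y \<alpha>" for y
    unfolding mi_power_def by (simp add: prod.remove[of UNIV i] ac_simps)
  ultimately show ?case
    using poly_fun.monom[of ?\<beta> "Suc n" c] monom by (simp add: ac_simps)
next
  case (add p q)
  then show ?case using poly_fun.add by (simp add: distrib_left)
qed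

lemma poly_fun_iter_dir_deriv: "poly_fun k (\<lambda>y. iter_dir_deriv k u (y - x) x)"
proof (induction k arbitrary: u)
  case (Suc k)
  \<comment> \<open>The factor \<open>(y - x) $ i\<close> is split: \<open>y $ i\<close> raises the
    degree by one, while \<open>- x $ i\<close> is a scalar.\<close>
  have "poly_fun (Suc k) (\<lambda>y. y $ i * iter_dir_deriv k (partial_deriv i u) (y - x) x
      + - x $ i * iter_dir_deriv k (partial_deriv i u) (y - x) x)" for i
    by (intro poly_fun.add poly_fun_coord_mult poly_fun_cmult Suc.IH poly_fun_mono[OF Suc.IH]) auto
  then have "poly_fun (Suc k) (\<lambda>y. \<Sum>i\<in>UNIV. y $ i * iter_dir_deriv k (partial_deriv i u) (y - x) x
      + - x $ i * iter_dir_deriv k (partial_deriv i u) (y - x) x)"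
    by (intro poly_fun_sum)
  then show ?case by (simp add: algebra_simps)
qed (simp add: poly_fun_const)

lemma poly_fun_taylor_poly: "m \<le> n \<Longrightarrow> poly_fun n (taylor_poly m u x)"
proof -
  assume "m \<le> n"
  then have "poly_fun n (\<lambda>y. \<Sum>k\<le>m. inverse (fact k) * iter_dir_deriv k u (y - x) x)"
    by (intro poly_fun_sum poly_fun_cmult poly_fun_mono[OF poly_fun_iter_dir_deriv]) auto
  then show ?thesis by (simp add: taylor_poly_def[abs_def] field_simps)
qed

lemma continuous_on_poly_fun: "poly_fun n p \<Longrightarrow> continuous_on A p"
  by (induction rule: poly_fun.induct) (auto simp: mi_power_def intro!: continuous_intros)

lemma consistent_poly_fun:
  assumes "poly_fun n p" and w: "consistent n \<Omega> I w X" and z: "z \<in> \<Omega>"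
  shows "p z = (\<Sum>a\<in>I. p (X a) * w a z)"
  using assms(1)
proof (induction rule: poly_fun.induct)
  case (monom \<alpha> c)
  then have "mi_power z \<alpha> = (\<Sum>a\<in>I. mi_power (X a) \<alpha> * w a z)"
    using w z unfolding consistent_def by blast
  then show ?case by (simp add: sum_distrib_left ac_simps)
qed (simp add: sum.distrib algebra_simps)

section \<open>Summation of the decay over the nodes\<close>

text \<open>Space is cut into cubes of side \<open>h / CARD('d)\<close>. Two points of one cube are
  at distance at most \<open>h\<close>, so a cube holds at most \<open>\<tau>\<close> nodes, and it
  remains to count the cubes that contain nodes from the large ball.\<close>

lemma card_inter_cball_le:
  fixes P :: "(real ^ 'd::finite) set" and R :: real
  assumes P: "finite P" "density_bounded h \<tau> P" and h: "0 < h" and R: "1 \<le> R"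
  shows "card (P \<inter> cball x (R * h)) \<le> \<tau> * (5 * CARD('d) * R) ^ CARD('d)"
proof -
  define cell where "cell y = (\<lambda>i. \<lfloor>(y $ i - x $ i) * CARD('d) / h\<rfloor>)" for y :: "real ^ 'd"
  define A where "A = P \<inter> cball x (R * h)"
  define k where "k = \<lceil>R * CARD('d)\<rceil>"
  have d: "1 \<le> real CARD('d)" by (simp add: Suc_leI)
  have Rd: "1 \<le> R * CARD('d)" using mult_mono[of 1 R 1 "real CARD('d)"] R d by simp
  have \<tau>: "0 \<le> \<tau>" using P(2) of_nat_0_le_iff order_trans unfolding density_bounded_def by blast
  have A: "finite A" using P by (simp add: A_def)
  have "cell y i \<in> {-k..k}" if "y \<in> A" for y i
  proof -
    from that have "norm (x - y) \<le> R * h" by (simp add: A_def dist_norm)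
    then have "\<bar>y $ i - x $ i\<bar> \<le> R * h"
      using component_le_norm_cart[of "x - y" i] by (simp add: abs_minus_commute)
    then have "\<bar>y $ i - x $ i\<bar> * CARD('d) \<le> (R * h) * CARD('d)"
      by (intro mult_right_mono) auto
    then have "\<bar>(y $ i - x $ i) * CARD('d) / h\<bar> \<le> R * CARD('d)"
      using h by (simp add: abs_mult pos_divide_le_eq mult.assoc mult.commute[of h])
    then show ?thesis unfolding cell_def k_def atLeastAtMost_iff by linarith
  qed
  then have "cell ` A \<subseteq> UNIV \<rightarrow>\<^sub>E {-k..k}" by auto
  then have "card (cell ` A) \<le> card (UNIV \<rightarrow>\<^sub>E {-k..k} :: ('d \<Rightarrow> int) set)"
    by (intro card_mono finite_PiE) auto
  also have "\<dots> = nat (2 * k + 1) ^ CARD('d)"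
    by (simp add: card_PiE algebra_simps)
  finally have "real (card (cell ` A)) \<le> real (nat (2 * k + 1)) ^ CARD('d)"
    unfolding of_nat_power[symmetric] of_nat_le_iff .
  also have "\<dots> \<le> (5 * CARD('d) * R) ^ CARD('d)"
  proof (rule power_mono)
    \<comment> \<open>With \<open>R * CARD('d) \<ge> 1\<close>, the number \<open>2 * k + 1\<close>
      of cubes per axis is at most \<open>2 * R * CARD('d) + 3\<close>, which is where the constant
      5 comes from.\<close>
    have "real_of_int k \<le> R * CARD('d) + 1" unfolding k_def by linarith
    with Rd show "real (nat (2 * k + 1)) \<le> 5 * CARD('d) * R"
      by (cases "0 \<le> 2 * k + 1") (auto simp: algebra_simps)
  qed simp
  finally have cells: "real (card (cell ` A)) \<le> (5 * CARD('d) * R) ^ CARD('d)" .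
  have fiber: "real (card {y \<in> A. cell y = g}) \<le> \<tau>" for g
  proof (cases "{y \<in> A. cell y = g} = {}")
    case True
    then show ?thesis using \<tau> by (simp only: card.empty of_nat_0)
  next
    case False
    then obtain z where z: "z \<in> A" "cell z = g" by auto
    have "y \<in> cball z h" if "y \<in> A" "cell y = g" for y
    proof -
      have "\<bar>(z - y) $ i\<bar> \<le> h / CARD('d)" for i
      proof -
        have "\<lfloor>(y $ i - x $ i) * CARD('d) / h\<rfloor> = \<lfloor>(z $ i - x $ i) * CARD('d) / h\<rfloor>"
          using fun_cong[OF trans[OF that(2) z(2)[symmetric]], of i] by (simp add: cell_def)
        then have "\<bar>(z $ i - x $ i) * CARD('d) / h - (y $ i - x $ i) * CARD('d) / h\<bar> \<le> 1"
          by linarith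
        also have "(z $ i - x $ i) * CARD('d) / h - (y $ i - x $ i) * CARD('d) / h = (z - y) $ i * CARD('d) / h"
          by (simp add: diff_divide_distrib algebra_simps)
        finally show ?thesis
          using h by (simp add: abs_mult pos_divide_le_eq pos_le_divide_eq del: vector_minus_component)
      qed
      then have "(\<Sum>i\<in>UNIV. \<bar>(z - y) $ i\<bar>) \<le> CARD('d) * (h / CARD('d))"
        by (intro sum_bounded_above) auto
      with norm_le_l1_cart[of "z - y"] show ?thesis by (simp add: dist_norm)
    qed
    then have "card {y \<in> A. cell y = g} \<le> card (P \<inter> cball z h)"
      using P by (intro card_mono) (auto simp: A_def)
    then show ?thesis
      using P(2) unfolding density_bounded_def by (meson of_nat_le_iff order_trans)
  qed
  have "real (card A) = (\<Sum>y\<in>A. 1)" by simp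
  also have "\<dots> = (\<Sum>g\<in>cell ` A. \<Sum>y\<in>{y \<in> A. cell y = g}. 1)"
    by (rule sum.group[symmetric]) (use A in auto)
  also have "\<dots> \<le> real (card (cell ` A)) * \<tau>"
    using fiber by (intro sum_bounded_above) simp
  also have "\<dots> \<le> (5 * CARD('d) * R) ^ CARD('d) * \<tau>"
    by (intro mult_right_mono cells \<tau>)
  finally show ?thesis by (simp add: A_def mult.commute)
qed

text \<open>On the shell \<open>lev y = k\<close> the summand is at most a multiple of
  \<open>r ^ k\<close>, and the node count is at most a multiple of
  \<open>2 ^ (k * CARD('d))\<close>. The hypothesis on \<open>q\<close> makes the ratio
  \<open>2 ^ CARD('d) * r\<close> less than one. The bound depends neither on \<open>x\<close> and
  \<open>h\<close> nor on the number of nodes.\<close>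

lemma sum_polynomial_decay_le:
  fixes P :: "(real ^ 'd::finite) set" and q h \<tau> :: real
  assumes P: "finite P" "density_bounded h \<tau> P" and h: "0 < h" and q: "real CARD('d) < 2 * q"
  shows "(\<Sum>y\<in>P. (1 + (norm ((x - y) /\<^sub>R h))\<^sup>2) powr - q)
    \<le> \<tau> * (5 * CARD('d)) ^ CARD('d) * 2 powr (2 * q) / (1 - 2 ^ CARD('d) * 2 powr (- 2 * q))"
proof -
  define \<rho> where "\<rho> y = norm ((x - y) /\<^sub>R h)" for y
  define lev where "lev y = (LEAST k. \<rho> y \<le> 2 ^ k)" for y
  define r :: real where "r = 2 powr (- 2 * q)"
  define b :: real where "b = \<tau> * (5 * CARD('d)) ^ CARD('d) * 2 powr (2 * q)"
  have q0: "0 < q" using q by (simp add: order_le_less_trans[of 0 "real CARD('d)"])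
  have r: "0 < r" by (simp add: r_def)
  have "2 ^ CARD('d) * r = 2 powr (CARD('d) - 2 * q)"
    by (simp add: r_def powr_diff powr_minus powr_realpow field_simps)
  also have "\<dots> < 2 powr 0" using q by (intro powr_less_mono) auto
  finally have t: "2 ^ CARD('d) * r < 1" by simp
  have \<tau>: "0 \<le> \<tau>" using P(2) of_nat_0_le_iff order_trans unfolding density_bounded_def by blast
  have lev: "\<rho> y \<le> 2 ^ lev y" for y
  proof -
    obtain k where "\<rho> y < 2 ^ k" using real_arch_pow[of 2 "\<rho> y"] by auto
    then show ?thesis unfolding lev_def by (intro LeastI[of "\<lambda>k. \<rho> y \<le> 2 ^ k" k]) simp
  qed
  \<comment> \<open>Minimality of \<open>lev y\<close> only yields
    \<open>\<rho> y > 2 ^ (lev y - 1)\<close>; the factor \<open>2 powr (2 * q)\<close>, the inverse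
    of \<open>r\<close>, makes up for the lost power. At level 0 the summand is at most 1.\<close>
  have "(1 + (\<rho> y)\<^sup>2) powr - q \<le> 2 powr (2 * q) * r ^ lev y" for y
  proof (cases "lev y")
    case 0
    have "(1 + (\<rho> y)\<^sup>2) powr - q \<le> 1 powr - q"
      using q0 by (intro powr_mono2') auto
    also have "\<dots> \<le> 2 powr (2 * q)" using q0 by (simp add: ge_one_powr_ge_zero)
    finally show ?thesis using 0 by simp
  next
    case (Suc j)
    then have "\<not> \<rho> y \<le> 2 ^ j" unfolding lev_def by (intro not_less_Least) simp
    then have "(2 ^ j)\<^sup>2 \<le> (\<rho> y)\<^sup>2" by (intro power_mono) auto
    then have "(1 + (\<rho> y)\<^sup>2) powr - q \<le> ((2 ^ j)\<^sup>2) powr - q"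
      using q0 by (intro powr_mono2') auto
    also have "(2 ^ j)\<^sup>2 = 2 powr (real j * 2)"
      using powr_realpow[of 2 "j * 2"] by (simp add: power_mult)
    also have "(2 powr (real j * 2)) powr - q = r powr real j"
      by (simp add: r_def powr_powr ac_simps)
    also have "\<dots> = r ^ j" using r by (rule powr_realpow)
    also have "\<dots> = 2 powr (2 * q) * r ^ lev y"
      by (simp add: Suc r_def powr_minus)
    finally show ?thesis .
  qed
  then have "(\<Sum>y\<in>P. (1 + (\<rho> y)\<^sup>2) powr - q) \<le> (\<Sum>y\<in>P. 2 powr (2 * q) * r ^ lev y)"
    by (intro sum_mono)
  also have "\<dots> = (\<Sum>k\<in>lev ` P. \<Sum>y\<in>{y \<in> P. lev y = k}. 2 powr (2 * q) * r ^ lev y)"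
    by (rule sum.group[symmetric]) (use P in auto)
  also have "\<dots> \<le> (\<Sum>k\<in>lev ` P. b * (2 ^ CARD('d) * r) ^ k)"
  proof (rule sum_mono)
    fix k
    have "card {y \<in> P. lev y = k} \<le> card (P \<inter> cball x (2 ^ k * h))"
    proof (intro card_mono subsetI)
      fix y assume "y \<in> {y \<in> P. lev y = k}"
      then show "y \<in> P \<inter> cball x (2 ^ k * h)"
        using lev[of y] h
        by (auto simp: \<rho>_def dist_norm divide_inverse_commute[symmetric] pos_divide_le_eq)
    qed (use P in simp)
    then have "real (card {y \<in> P. lev y = k}) \<le> \<tau> * (5 * CARD('d) * 2 ^ k) ^ CARD('d)"
      using card_inter_cball_le[OF P h, of "2 ^ k" x] by simp
    then have "real (card {y \<in> P. lev y = k}) * (2 powr (2 * q) * r ^ k)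
        \<le> \<tau> * (5 * CARD('d) * 2 ^ k) ^ CARD('d) * (2 powr (2 * q) * r ^ k)"
      using r by (intro mult_right_mono) auto
    also have "\<dots> = b * (2 ^ CARD('d) * r) ^ k"
      by (simp add: b_def power_mult_distrib power_mult[symmetric] mult.commute[of k])
    finally show "(\<Sum>y\<in>{y \<in> P. lev y = k}. 2 powr (2 * q) * r ^ lev y) \<le> b * (2 ^ CARD('d) * r) ^ k"
      by simp
  qed
  also have "\<dots> = b * (\<Sum>k\<in>lev ` P. (2 ^ CARD('d) * r) ^ k)"
    by (simp add: sum_distrib_left)
  also have "\<dots> \<le> b * (1 / (1 - 2 ^ CARD('d) * r))"
  proof (rule mult_left_mono)
    \<comment> \<open>The occupied levels are distinct exponents, so their sum is part of the full
      geometric series.\<close>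
    have "(\<Sum>k\<in>lev ` P. (2 ^ CARD('d) * r) ^ k) \<le> (\<Sum>k. (2 ^ CARD('d) * r) ^ k)"
      using P(1) r t by (intro sum_le_suminf summable_geometric) auto
    also have "\<dots> = 1 / (1 - 2 ^ CARD('d) * r)"
      using r t by (intro suminf_geometric) auto
    finally show "(\<Sum>k\<in>lev ` P. (2 ^ CARD('d) * r) ^ k) \<le> 1 / (1 - 2 ^ CARD('d) * r)" .
  qed (use \<tau> in \<open>simp add: b_def\<close>)
  finally show ?thesis by (simp add: \<rho>_def b_def r_def)
qed

section \<open>Error estimate\<close>

lemma finite_mi_size_eq: "finite {\<alpha> :: 'd::finite \<Rightarrow> nat. mi_size \<alpha> = k}"
proof (rule finite_subset)
  show "{\<alpha>. mi_size \<alpha> = k} \<subseteq> UNIV \<rightarrow>\<^sub>E {..k}"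
    by (auto simp: mi_size_def intro: member_le_sum)
qed (simp add: finite_PiE)

text \<open>A real supremum bounds its terms only if they are bounded above. On \<open>K\<close> the
  function \<open>mi_deriv_closed K \<alpha> u\<close> agrees with the continuous extension
  \<open>g\<close>, which is bounded by compactness.\<close>

lemma mi_deriv_le_deriv_sup_norm:
  fixes K :: "(real ^ 'd::finite) set"
  assumes K: "compact K" "convex K" and u: "Ck_closed k K u" and \<alpha>: "mi_size \<alpha> \<le> k"
    and x: "x \<in> interior K"
  shows "\<bar>mi_deriv \<alpha> u x\<bar> \<le> deriv_sup_norm (mi_size \<alpha>) K u"
proof -
  have cl: "closure (interior K) = K"
    using convex_closure_interior[OF K(2)] x K(1) by (auto simp: compact_imp_closed)
  obtain g where g: "continuous_on K g" "\<And>y. y \<in> interior K \<Longrightarrow> g y = mi_deriv \<alpha> u y"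
    using u \<alpha> unfolding Ck_closed_def by blast
  have eq: "mi_deriv_closed K \<alpha> u y = g y" if y: "y \<in> K" for y
  proof (cases "y \<in> interior K")
    case False
    then have "y islimpt interior K" using y cl by (auto simp: closure_def)
    \<comment> \<open>\<open>Lim\<close> is determined only along a nontrivial filter; a convex set
      with nonempty interior provides this at each of its boundary points.\<close>
    then have nontriv: "\<not> trivial_limit (at y within interior K)"
      by (simp add: trivial_limit_within)
    have "(g \<longlongrightarrow> g y) (at y within interior K)"
      using g(1) y interior_subset tendsto_within_subset unfolding continuous_on_def by blast
    then have "(mi_deriv \<alpha> u \<longlongrightarrow> g y) (at y within interior K)"
      by (rule Lim_transform_eventually) (auto simp: g(2) eventually_at_filter)
    then show ?thesis using False tendsto_Lim[OF nontriv] by (simp add: mi_deriv_closed_def)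
  qed (simp add: mi_deriv_closed_def g)
  have xK: "x \<in> K" using x interior_subset by blast
  have "bounded (g ` K)" using compact_continuous_image[OF g(1) K(1)] compact_imp_bounded by blast
  then obtain B where B: "\<And>y. y \<in> K \<Longrightarrow> \<bar>g y\<bar> \<le> B" unfolding bounded_iff by auto
  have "\<bar>mi_deriv \<alpha> u x\<bar> = \<bar>mi_deriv_closed K \<alpha> u x\<bar>"
    using x by (simp add: mi_deriv_closed_def)
  also have "\<dots> \<le> (SUP y\<in>K. \<bar>mi_deriv_closed K \<alpha> u y\<bar>)"
    by (rule cSUP_upper[OF xK]) (use B eq in \<open>auto intro!: bdd_aboveI\<close>)
  also have "\<dots> \<le> deriv_sup_norm (mi_size \<alpha>) K u"
    unfolding deriv_sup_norm_def by (rule Max_ge) (auto intro: finite_mi_size_eq)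
  finally show ?thesis .
qed

lemma deriv_sup_norm_nonneg:
  fixes K :: "(real ^ 'd::finite) set"
  assumes "compact K" "convex K" "Ck_closed k K u" "x \<in> interior K"
  shows "0 \<le> deriv_sup_norm k K u"
proof -
  \<comment> \<open>The maximum is nonnegative because some multiindex of size \<open>k\<close>
    exists: the one concentrated in a single coordinate.\<close>
  have "mi_size (\<lambda>i :: 'd. if i = undefined then k else 0) = k"
    by (simp add: mi_size_def)
  with mi_deriv_le_deriv_sup_norm[OF assms(1-3) _ assms(4)] show ?thesis
    by (metis abs_ge_zero order.refl order.trans)
qed

lemma poly_decayD:
  assumes "poly_decay r s c h \<Omega> I w X" "mi_size \<alpha> \<le> r" "x \<in> \<Omega>" "a \<in> I"
  shows "(1 + (norm ((x - X a) /\<^sub>R h))\<^sup>2) powr s * h ^ mi_size \<alpha> * \<bar>mi_deriv \<alpha> (w a) x\<bar> < c"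
proof -
  let ?F = "\<lambda>\<alpha> x a. ereal ((1 + (norm ((x - X a) /\<^sub>R h))\<^sup>2) powr s * h ^ mi_size \<alpha> * \<bar>mi_deriv \<alpha> (w a) x\<bar>)"
  have "?F \<alpha> x a \<le> (SUP a\<in>I. ?F \<alpha> x a)"
    using assms(4) by (rule SUP_upper)
  also have "\<dots> \<le> (SUP x\<in>\<Omega>. SUP a\<in>I. ?F \<alpha> x a)"
    using assms(3) by (rule SUP_upper)
  also have "\<dots> \<le> (SUP \<alpha>\<in>{\<alpha>. mi_size \<alpha> \<le> r}. SUP x\<in>\<Omega>. SUP a\<in>I. ?F \<alpha> x a)"
    by (rule SUP_upper) (simp add: assms(2))
  also have "\<dots> < ereal c"
    using assms(1) unfolding poly_decay_def by (rule conjunct2)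
  finally show ?thesis by simp
qed

lemma mi_deriv_approximant:
  fixes x :: "real ^ 'd::finite"
  assumes "\<And>a. a \<in> I \<Longrightarrow> Ck_on (mi_size \<alpha>) S (w a)" "open S" "x \<in> S"
  shows "mi_deriv \<alpha> (approximant I w X u) x = (\<Sum>a\<in>I. u (X a) * mi_deriv \<alpha> (w a) x)"
  using foldr_partial_deriv_sum[of I "mi_list \<alpha>" S w x "\<lambda>a. u (X a)"] assms
  by (simp add: mi_deriv_def approximant_def[abs_def] length_mi_list)

text \<open>Nodes may lie on the boundary of the hull, where the segment argument does not apply.
  Both sides are continuous in \<open>y\<close>, so the estimate passes from the interior to its
  closure.\<close>

lemma taylor_remainder_closure:
  fixes x y :: "real ^ 'd::finite"
  assumes K: "compact K" "convex K" and u: "Ck_closed (Suc m) K u" and x: "x \<in> interior K" and y: "y \<in> K"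
  shows "\<bar>u y - taylor_poly m u x y\<bar> \<le> (CARD('d) * norm (y - x)) ^ Suc m * deriv_sup_norm (Suc m) K u"
proof -
  let ?N = "deriv_sup_norm (Suc m) K u"
  have cl: "closure (interior K) = K"
    using convex_closure_interior[OF K(2)] x K(1) by (auto simp: compact_imp_closed)
  have Ck: "Ck_on (Suc m) (interior K) u" using u unfolding Ck_closed_def by blast
  have N: "\<bar>foldr partial_deriv is u z\<bar> \<le> ?N" if "z \<in> interior K" "length is = Suc m" for z "is"
    using mi_deriv_le_deriv_sup_norm[OF K u, of "count_list is" z]
      foldr_partial_deriv_eq_mi_deriv[of "is" "interior K" u z] Ck that by simp
  have "\<bar>u z - taylor_poly m u x z\<bar> - (CARD('d) * norm (z - x)) ^ Suc m * ?N \<le> 0"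
    if "z \<in> interior K" for z
    using taylor_remainder[OF Ck _ _ x that N] K(2) by (simp add: convex_interior)
  moreover have "continuous_on K (\<lambda>z. \<bar>u z - taylor_poly m u x z\<bar> - (CARD('d) * norm (z - x)) ^ Suc m * ?N)"
    using u unfolding Ck_closed_def
    by (intro continuous_intros continuous_on_poly_fun[OF poly_fun_taylor_poly[OF order_refl]]) auto
  ultimately have "\<bar>u y - taylor_poly m u x y\<bar> - (CARD('d) * norm (y - x)) ^ Suc m * ?N \<le> 0"
    using continuous_le_on_closure[of "interior K"] y unfolding cl by blast
  then show ?thesis by simp
qed

lemma Ck_closed_mono: "Ck_closed k K u \<Longrightarrow> j \<le> k \<Longrightarrow> Ck_closed j K u"
  unfolding Ck_closed_def by (meson Ck_on_mono order_trans)

lemma closed_conv_domain: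
  assumes "is_domain \<Omega>"
  shows "compact (closed_conv \<Omega>)" "convex (closed_conv \<Omega>)" "\<Omega> \<subseteq> interior (closed_conv \<Omega>)"
proof -
  have "open \<Omega>" "bounded \<Omega>" using assms by (auto simp: is_domain_def)
  then show "compact (closed_conv \<Omega>)" "convex (closed_conv \<Omega>)"
    by (auto simp: closed_conv_def bounded_convex_hull compact_closure intro: convex_closure)
  have "convex hull \<Omega> \<subseteq> interior (closed_conv \<Omega>)"
    using \<open>open \<Omega>\<close> by (intro interior_maximal) (auto simp: closed_conv_def open_convex_hull closure_subset)
  then show "\<Omega> \<subseteq> interior (closed_conv \<Omega>)" using hull_subset[of \<Omega>] by blast
qed

text \<open>The sum over the nodes is kept explicit here. Its exponent combines the decay
  \<open>s\<close> with the loss \<open>(real m + 1) / 2\<close> caused by the growth of the Taylor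
  remainder.\<close>

lemma approximation_error:
  fixes x :: "real ^ 'd::finite" and X :: "'i \<Rightarrow> real ^ 'd" and c :: real
  assumes \<Omega>: "is_domain \<Omega>" and h: "0 < h" and X: "X ` I \<subseteq> closed_conv \<Omega>"
    and cons: "consistent m \<Omega> I w X"
    and decay: "poly_decay r s c h \<Omega> I w X" and u: "Ck_closed (Suc m) (closed_conv \<Omega>) u"
    and \<alpha>: "mi_size \<alpha> \<le> m" "mi_size \<alpha> \<le> r" and x: "x \<in> \<Omega>"
  shows "\<bar>mi_deriv \<alpha> (approximant I w X u) x - mi_deriv \<alpha> u x\<bar>
    \<le> real CARD('d) ^ Suc m * c * deriv_sup_norm (Suc m) (closed_conv \<Omega>) u * h ^ (Suc m - mi_size \<alpha>)
      * (\<Sum>a\<in>I. (1 + (norm ((x - X a) /\<^sub>R h))\<^sup>2) powr - (s - (real m + 1) / 2))"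
proof -
  define K where "K = closed_conv \<Omega>"
  define N where "N = deriv_sup_norm (Suc m) K u"
  define T where "T = taylor_poly m u x"
  note K = closed_conv_domain[OF \<Omega>, folded K_def]
  have "open \<Omega>" using \<Omega> by (simp add: is_domain_def)
  have xK: "x \<in> interior K" using x K(3) by blast
  have XK: "X a \<in> K" if "a \<in> I" for a using X that by (auto simp: K_def)
  have w: "Ck_on (mi_size \<alpha>) \<Omega> (w a)" if "a \<in> I" for a
    using decay that \<alpha>(2) Ck_on_mono unfolding poly_decay_def by blast
  have Ck: "Ck_on m (interior K) u"
    using u Ck_on_mono[of "Suc m" "interior K" u m] by (simp add: Ck_closed_def K_def del: Ck_on.simps)
  \<comment> \<open>This holds only at the center \<open>x\<close>. Reproduction of
    \<open>T\<close>, in contrast, holds on all of the open set \<open>\<Omega>\<close> with the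
    center fixed, and so may be differentiated.\<close>
  have "mi_deriv \<alpha> u x = mi_deriv \<alpha> T x"
    unfolding T_def using mi_deriv_taylor_poly[OF Ck \<alpha>(1) _ xK] by simp
  also have "\<dots> = mi_deriv \<alpha> (approximant I w X T) x"
    unfolding mi_deriv_def
  proof (rule foldr_partial_deriv_cong[OF \<open>open \<Omega>\<close> _ x])
    fix z assume "z \<in> \<Omega>"
    then show "T z = approximant I w X T z"
      unfolding approximant_def T_def
      by (rule consistent_poly_fun[OF poly_fun_taylor_poly[OF order_refl] cons])
  qed
  also have "\<dots> = (\<Sum>a\<in>I. T (X a) * mi_deriv \<alpha> (w a) x)"
    by (rule mi_deriv_approximant[OF w \<open>open \<Omega>\<close> x])
  finally have "mi_deriv \<alpha> (approximant I w X u) x - mi_deriv \<alpha> u x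
      = (\<Sum>a\<in>I. (u (X a) - T (X a)) * mi_deriv \<alpha> (w a) x)"
    using mi_deriv_approximant[OF w \<open>open \<Omega>\<close> x, where X = X and u = u]
    by (simp add: sum_subtractf left_diff_distrib)
  also have "\<bar>\<dots>\<bar> \<le> (\<Sum>a\<in>I. \<bar>(u (X a) - T (X a)) * mi_deriv \<alpha> (w a) x\<bar>)"
    by (rule sum_abs)
  also have "\<dots> \<le> (\<Sum>a\<in>I. real CARD('d) ^ Suc m * c * N * h ^ (Suc m - mi_size \<alpha>)
      * (1 + (norm ((x - X a) /\<^sub>R h))\<^sup>2) powr - (s - (real m + 1) / 2))"
  proof (rule sum_mono)
    fix a assume a: "a \<in> I"
    define \<rho> where "\<rho> = norm ((x - X a) /\<^sub>R h)"
    define W where "W = \<bar>mi_deriv \<alpha> (w a) x\<bar>"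
    have "norm (X a - x) = h * \<rho>" using h by (simp add: \<rho>_def norm_minus_commute)
    then have R: "\<bar>u (X a) - T (X a)\<bar> \<le> (CARD('d) * (h * \<rho>)) ^ Suc m * N"
      using taylor_remainder_closure[OF K(1,2) u[folded K_def] xK XK[OF a]] by (simp only: T_def N_def)
    have pos: "1 + \<rho>\<^sup>2 > 0" by (simp add: add_pos_nonneg)
    have "0 \<le> N" unfolding N_def by (rule deriv_sup_norm_nonneg[OF K(1,2) u[folded K_def] xK])
    have "(1 + \<rho>\<^sup>2) powr s * h ^ mi_size \<alpha> * W < c"
      unfolding \<rho>_def W_def by (rule poly_decayD[OF decay \<alpha>(2) x a])
    then have W: "h ^ mi_size \<alpha> * W \<le> c * (1 + \<rho>\<^sup>2) powr - s"
      using pos by (simp add: powr_minus field_simps)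
    \<comment> \<open>Written as a power of \<open>\<rho>\<^sup>2\<close>, the growth of the
      remainder can be absorbed into the decay weight. The case \<open>\<rho> = 0\<close> is
      separate, since \<open>powr_realpow\<close> needs a positive base.\<close>
    have "\<rho> ^ Suc m = (\<rho>\<^sup>2) powr ((real m + 1) / 2)"
    proof (cases "\<rho> = 0")
      case False
      then have "\<rho> > 0" by (simp add: \<rho>_def)
      have "(\<rho>\<^sup>2) powr ((real m + 1) / 2) = (\<rho> powr 2) powr ((real m + 1) / 2)"
        using \<open>\<rho> > 0\<close> by simp
      also have "\<dots> = \<rho> powr real (Suc m)"
        by (simp add: powr_powr add_divide_distrib add.commute)
      also have "\<dots> = \<rho> ^ Suc m" using \<open>\<rho> > 0\<close> by (rule powr_realpow)
      finally show ?thesis by (rule sym)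
    qed simp
    also have "\<dots> \<le> (1 + \<rho>\<^sup>2) powr ((real m + 1) / 2)"
      by (intro powr_mono2) auto
    finally have \<rho>: "\<rho> ^ Suc m \<le> (1 + \<rho>\<^sup>2) powr ((real m + 1) / 2)" .
    have "\<bar>(u (X a) - T (X a)) * mi_deriv \<alpha> (w a) x\<bar> \<le> (CARD('d) * (h * \<rho>)) ^ Suc m * N * W"
      unfolding abs_mult W_def by (intro mult_right_mono R) simp
    \<comment> \<open>Of the \<open>Suc m\<close> powers of \<open>h\<close>,
      \<open>mi_size \<alpha>\<close> are spent on the decay bound for the derivative of the shape
      function; the others form the rate.\<close>
    also have "\<dots> = real CARD('d) ^ Suc m * N * h ^ (Suc m - mi_size \<alpha>) * (\<rho> ^ Suc m * (h ^ mi_size \<alpha> * W))"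
    proof -
      have "h ^ Suc m = h ^ (Suc m - mi_size \<alpha>) * h ^ mi_size \<alpha>"
        using \<alpha>(1) by (subst power_add[symmetric]) simp
      then show ?thesis by (simp add: power_mult_distrib del: power_Suc)
    qed
    also have "\<dots> \<le> real CARD('d) ^ Suc m * N * h ^ (Suc m - mi_size \<alpha>) *
        ((1 + \<rho>\<^sup>2) powr ((real m + 1) / 2) * (c * (1 + \<rho>\<^sup>2) powr - s))"
      using h \<open>0 \<le> N\<close> by (intro mult_left_mono mult_mono \<rho> W) (auto simp: W_def)
    also have "\<dots> = real CARD('d) ^ Suc m * c * N * h ^ (Suc m - mi_size \<alpha>) * (1 + \<rho>\<^sup>2) powr - (s - (real m + 1) / 2)"
      by (simp add: powr_add[symmetric] ac_simps)
    finally show "\<bar>(u (X a) - T (X a)) * mi_deriv \<alpha> (w a) x\<bar> \<le> real CARD('d) ^ Suc m * c * N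
        * h ^ (Suc m - mi_size \<alpha>) * (1 + (norm ((x - X a) /\<^sub>R h))\<^sup>2) powr - (s - (real m + 1) / 2)"
      by (simp only: \<rho>_def)
  qed
  finally show ?thesis by (simp add: sum_distrib_left N_def K_def)
qed

theorem theorem1:
  fixes \<Omega> :: "(real ^ 'd::finite) set"
    and n l r m :: nat
    and s c \<tau> :: real
  assumes "is_domain \<Omega>"
    and "m = min n l"
    and "\<tau> > 0"
    and "c > 0"
    and "2 * s > real CARD('d) + real m + 1"
  shows "\<exists>C::real. \<forall>h>0. \<forall>(I :: 'i set) (w :: 'i \<Rightarrow> real ^ 'd \<Rightarrow> real) (X :: 'i \<Rightarrow> real ^ 'd)
             (u :: real ^ 'd \<Rightarrow> real).
           approx_scheme I X \<longrightarrow>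
           X ` I \<subseteq> closed_conv \<Omega> \<longrightarrow>
           consistent n \<Omega> I w X \<longrightarrow>
           density_bounded h \<tau> (X ` I) \<longrightarrow>
           poly_decay r s c h \<Omega> I w X \<longrightarrow>
           Ck_closed (l + 1) (closed_conv \<Omega>) u \<longrightarrow>
           (\<forall>\<alpha>. mi_size \<alpha> \<le> min m r \<longrightarrow>
             (\<forall>x\<in>\<Omega>. \<bar>mi_deriv \<alpha> (approximant I w X u) x - mi_deriv \<alpha> u x\<bar>
                \<le> C * deriv_sup_norm (m + 1) (closed_conv \<Omega>) u * h ^ (m + 1 - mi_size \<alpha>)))"
proof -
  \<comment> \<open>With this \<open>q\<close>, the assumption on \<open>s\<close> says exactly that
    \<open>2 * q > CARD('d)\<close>.\<close>
  define q where "q = s - (real m + 1) / 2"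
  define B where "B = \<tau> * (5 * CARD('d)) ^ CARD('d) * 2 powr (2 * q) / (1 - 2 ^ CARD('d) * 2 powr (- 2 * q))"
  \<comment> \<open>The constant depends only on the dimension, \<open>m\<close>, \<open>s\<close>,
    \<open>c\<close> and \<open>\<tau>\<close>, so it can be chosen before \<open>h\<close>, the
    scheme and \<open>u\<close>.\<close>
  show ?thesis
  proof (intro exI[of _ "real CARD('d) ^ Suc m * c * B"] allI impI ballI)
    fix h :: real and I :: "'i set" and w :: "'i \<Rightarrow> real ^ 'd \<Rightarrow> real" and X :: "'i \<Rightarrow> real ^ 'd" 
      and u :: "real ^ 'd \<Rightarrow> real" and \<alpha> :: "'d \<Rightarrow> nat" and x :: "real ^ 'd"
    assume h: "0 < h" and scheme: "approx_scheme I X" and X: "X ` I \<subseteq> closed_conv \<Omega>"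
      and cons: "consistent n \<Omega> I w X" and density: "density_bounded h \<tau> (X ` I)"
      and decay: "poly_decay r s c h \<Omega> I w X" and u: "Ck_closed (l + 1) (closed_conv \<Omega>) u"
      and \<alpha>: "mi_size \<alpha> \<le> min m r" and x: "x \<in> \<Omega>"
    let ?N = "deriv_sup_norm (Suc m) (closed_conv \<Omega>) u"
    have cons': "consistent m \<Omega> I w X"
      using cons assms(2) by (auto simp: consistent_def)
    have u': "Ck_closed (Suc m) (closed_conv \<Omega>) u"
      using u assms(2) by (intro Ck_closed_mono[OF u]) simp
    \<comment> \<open>Injectivity of \<open>X\<close> turns the sum over indices into one over the
      point set, which is what the density bound counts.\<close>
    have "(\<Sum>a\<in>I. (1 + (norm ((x - X a) /\<^sub>R h))\<^sup>2) powr - q)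
        = (\<Sum>y\<in>X ` I. (1 + (norm ((x - y) /\<^sub>R h))\<^sup>2) powr - q)"
      using scheme by (simp add: approx_scheme_def sum.reindex)
    also have "\<dots> \<le> B"
      unfolding B_def using scheme assms(5)
      by (intro sum_polynomial_decay_le density h) (auto simp: approx_scheme_def q_def field_simps)
    finally have B: "(\<Sum>a\<in>I. (1 + (norm ((x - X a) /\<^sub>R h))\<^sup>2) powr - q) \<le> B" .
    have "0 \<le> ?N"
      using closed_conv_domain[OF assms(1)] x by (intro deriv_sup_norm_nonneg[OF _ _ u', of x]) auto
    have "\<bar>mi_deriv \<alpha> (approximant I w X u) x - mi_deriv \<alpha> u x\<bar>
        \<le> real CARD('d) ^ Suc m * c * ?N * h ^ (Suc m - mi_size \<alpha>)
          * (\<Sum>a\<in>I. (1 + (norm ((x - X a) /\<^sub>R h))\<^sup>2) powr - q)"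
      unfolding q_def using \<alpha> by (intro approximation_error[OF assms(1) h X cons' decay u' _ _ x]) auto
    also have "\<dots> \<le> real CARD('d) ^ Suc m * c * ?N * h ^ (Suc m - mi_size \<alpha>) * B"
      using \<open>0 \<le> ?N\<close> assms(4) h by (intro mult_left_mono B) simp
    finally show "\<bar>mi_deriv \<alpha> (approximant I w X u) x - mi_deriv \<alpha> u x\<bar>
        \<le> real CARD('d) ^ Suc m * c * B * deriv_sup_norm (m + 1) (closed_conv \<Omega>) u * h ^ (m + 1 - mi_size \<alpha>)"
      by (simp add: ac_simps)
  qed
qed

end
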